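(* Let $\mathsf{N}\subset\mathsf{H}$ be a Lagrangian subspace and let $\mathcal{T}:\mathsf{M}\to\mathsf{M}$ be the bi-Fredholm operator represented by $\mathsf{N}$. For $g\in \mathrm{SL}_2(\mathbb{R})$ let $\mathsf{N}^g=\{\mathcal{M}_{\mathcal{U}}(g)z \mid z\in \mathsf{N}\}$. A scalar $\lambda\in\mathbb{R}$ is an eigenvalue of $\mathcal{T}$ if and only if the intersection $\bigcap_{g\in N_\lambda}\mathsf{N}^g$ is non-zero, where $N_\lambda$ is the subgroup $$N_\lambda=\left\{\begin{pmatrix}1-\lambda t & \lambda^2 t\\ -t & 1+\lambda t\end{pmatrix} \;\middle|\; t\in\mathbb{R}\right\}\subset \mathrm{SL}_2(\mathbb{R}).$$ The subgroup $N_{\rm sh}=\left\{\begin{pmatrix}1&t\\0&1\end{pmatrix} \;\middle|\; t\in\mathbb{R}\right\}$ plays the same role for the infinite eigenvalue: $\infty$ is an eigenvalue of $\mathcal{T}$ if and only if $\bigcap_{g\in N_{\rm sh}}\mathsf{N}^g$ is non-zero.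
   Context: Setting. $\mathsf{H}$ is a separable real Hilbert space (finite or infinite dimensional), $\mathsf{M}\subset\mathsf{H}$ is a closed subspace with $\dim\mathsf{M}=\dim\mathsf{M}^\perp$, and $\mathcal{U}:\mathsf{M}\to\mathsf{M}^\perp$ is a fixed unitary (isometric linear bijection). Elements of $\mathsf{H}=\mathsf{M}^\perp\oplus\mathsf{M}$ (orthogonal sum) are written $(y,x)$ with $y\in\mathsf{M}^\perp$, $x\in\mathsf{M}$. The symplectic form on $\mathsf{H}$ is $\omega((y,x);(y',x'))=\langle \mathcal{U}x,y'\rangle-\langle \mathcal{U}^*y,x'\rangle$. The symplectic complement of a subspace $\mathsf{L}$ is $\mathsf{L}^\circ=\{z\in\mathsf{H}\mid \omega(z;z')=0 \text{ for all } z'\in\mathsf{L}\}$; $\mathsf{L}$ is Lagrangian if $\mathsf{L}=\mathsf{L}^\circ$. Action. For $g=\begin{pmatrix}a&b\\c&d\end{pmatrix}\in\mathrm{SL}_2(\mathbb{R})$ the operator $\mathcal{M}_{\mathcal{U}}(g):\mathsf{H}\to\mathsf{H}$ is $\mathcal{M}_{\mathcal{U}}(g)(y,x)=(ay+b\,\mathcal{U}x,\; c\,\mathcal{U}^*y+dx)$. Bi-Fredholm operators. For a Lagrangian subspace $\mathsf{N}$ put $\mathsf{M}_{00}=\mathsf{M}\cap\mathsf{N}$, $\mathsf{M}_{01}=\mathsf{M}\cap\mathsf{N}^\perp$, $\mathsf{M}_{10}=\mathsf{M}^\perp\cap\mathsf{N}$, $\mathsf{M}_{11}=\mathsf{M}^\perp\cap\mathsf{N}^\perp$,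 and let $\mathsf{M}_0\subset\mathsf{M}$, $\mathsf{M}_1\subset\mathsf{M}^\perp$ be the closed subspaces with $\mathsf{M}=\mathsf{M}_{00}\oplus\mathsf{M}_{01}\oplus\mathsf{M}_0$ and $\mathsf{M}^\perp=\mathsf{M}_{10}\oplus\mathsf{M}_{11}\oplus\mathsf{M}_1$ (orthogonal sums). Decompose orthogonally $\mathsf{N}=\mathsf{N}_{\bullet}\oplus\mathsf{N}_{\#}\oplus\mathsf{N}_\infty$ with $\mathsf{N}_\bullet=\mathsf{M}_{00}$, $\mathsf{N}_\infty=\mathsf{M}_{10}$ and $\mathsf{N}_\#$ the orthogonal complement of $\mathsf{N}_\bullet\oplus\mathsf{N}_\infty$ in $\mathsf{N}$. There are (possibly unbounded) self-adjoint operators $\hat{\mathcal{T}}$ on $\mathsf{M}_0\oplus\mathsf{M}_{00}$ and $\check{\mathcal{T}}$ on $\mathsf{M}_1\oplus\mathsf{M}_{10}$ such that $\mathsf{N}_\#\oplus\mathsf{N}_\bullet=\{(\mathcal{U}\hat{\mathcal{T}}x,x)\mid x\in\mathrm{Dom}(\hat{\mathcal{T}})\}$ and $\mathsf{N}_\#\oplus\mathsf{N}_\infty=\{(y,\mathcal{U}^*\check{\mathcal{T}}y)\mid y\in\mathrm{Dom}(\check{\mathcal{T}})\}$. The pair $(\hat{\mathcal{T}},\check{\mathcal{T}})$ is called the bi-Fredholm operator $\mathcal{T}:\mathsf{M}\to\mathsf{M}$ represented by $\mathsf{N}$ (and $\mathsf{N}$ is called its graph). Eigenvalues. $\lambda\in\mathbb{R}$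 is an eigenvalue of $\mathcal{T}$ if $\hat{\mathcal{T}}x=\lambda x$ for some non-zero $x\in\mathrm{Dom}(\hat{\mathcal{T}})$, equivalently if $(\lambda\,\mathcal{U}x,x)\in\mathsf{N}$ for some non-zero $x\in\mathsf{M}$. The eigenvectors for the infinite eigenvalue are the non-zero vectors of $\mathsf{N}_\infty=\mathsf{M}^\perp\cap\mathsf{N}$; $\infty$ is an eigenvalue of $\mathcal{T}$ if $\mathsf{N}_\infty\neq\{0\}$. *)

theory Defs
  imports "HOL-Analysis.Analysis"
begin

section \<open>The splitting of the Hilbert space\<close>

text \<open>
  The Hilbert space \<open>H\<close> is the whole type, of sort \<open>{real_inner, polish_space}\<close>; on a real inner
  product space the class \<open>polish_space\<close> says exactly complete and separable.  The pair written
  \<open>(y, x)\<close> with \<open>y\<close> in \<open>M\<^sup>\<bottom>\<close> and \<open>x\<close> in \<open>M\<close> is the vector \<open>y + x\<close>.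
\<close>

definition proj :: "'a::real_inner set \<Rightarrow> 'a \<Rightarrow> 'a" where
  "proj M z = (THE x. x \<in> M \<and> z - x \<in> M\<^sup>\<bottom>)"

definition linear_between :: "'a::real_vector set \<Rightarrow> 'b::real_vector set \<Rightarrow> ('a \<Rightarrow> 'b) \<Rightarrow> bool" where
  "linear_between S T f \<longleftrightarrow> f ` S \<subseteq> T \<and>
     (\<forall>x\<in>S. \<forall>y\<in>S. f (x + y) = f x + f y) \<and> (\<forall>c. \<forall>x\<in>S. f (c *\<^sub>R x) = c *\<^sub>R f x)"

definition unitary_between :: "'a::real_normed_vector set \<Rightarrow> 'b::real_normed_vector set \<Rightarrow> ('a \<Rightarrow> 'b) \<Rightarrow> bool" where
  "unitary_between S T U \<longleftrightarrow> linear_between S T U \<and> bij_betw U S T \<and> (\<forall>x\<in>S. norm (U x) = norm x)"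

text \<open>\<open>adj M U\<close> is the adjoint of an operator \<open>U\<close> whose domain is \<open>M\<close> only, so the library's
  \<open>adjoint\<close> does not apply.\<close>

definition adj :: "'a::real_inner set \<Rightarrow> ('a \<Rightarrow> 'b::real_inner) \<Rightarrow> 'b \<Rightarrow> 'a" where
  "adj M U y = (THE x. x \<in> M \<and> (\<forall>x'\<in>M. inner (U x') y = inner x' x))"

section \<open>Lagrangian subspaces and the action of the special linear group\<close>

definition symp :: "'a::real_inner set \<Rightarrow> ('a \<Rightarrow> 'a) \<Rightarrow> 'a \<Rightarrow> 'a \<Rightarrow> real" where
  "symp M U z z' = inner (U (proj M z)) (proj (M\<^sup>\<bottom>) z') - inner (adj M U (proj (M\<^sup>\<bottom>) z)) (proj M z')"

definition symp_comp :: "'a::real_inner set \<Rightarrow> ('a \<Rightarrow> 'a) \<Rightarrow> 'a set \<Rightarrow> 'a set" where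
  "symp_comp M U L = {z. \<forall>z'\<in>L. symp M U z z' = 0}"

definition lagrangian :: "'a::real_inner set \<Rightarrow> ('a \<Rightarrow> 'a) \<Rightarrow> 'a set \<Rightarrow> bool" where
  "lagrangian M U L \<longleftrightarrow> subspace L \<and> L = symp_comp M U L"

definition SL2 :: "(real^2^2) set" where
  "SL2 = {g. det g = 1}"

definition act :: "'a::real_inner set \<Rightarrow> ('a \<Rightarrow> 'a) \<Rightarrow> real^2^2 \<Rightarrow> 'a \<Rightarrow> 'a" where
  "act M U g z =
     (let y = proj (M\<^sup>\<bottom>) z; x = proj M z
      in (g$1$1 *\<^sub>R y + g$1$2 *\<^sub>R U x) + (g$2$1 *\<^sub>R adj M U y + g$2$2 *\<^sub>R x))"

definition N_fin :: "real \<Rightarrow> (real^2^2) set" where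
  "N_fin l = {vector [vector [1 - l * t, l\<^sup>2 * t], vector [- t, 1 + l * t]] | t. True}"

definition N_sh :: "(real^2^2) set" where
  "N_sh = {vector [vector [1, t], vector [0, 1]] | t. True}"

section \<open>Bi-Fredholm operators\<close>

text \<open>A partially defined operator is its domain together with a function, whose values outside
  the domain are irrelevant.\<close>

type_synonym 'a partial_op = "'a set \<times> ('a \<Rightarrow> 'a)"

definition op_graph :: "'a partial_op \<Rightarrow> ('a \<times> 'a) set" where
  "op_graph T = {(x, snd T x) | x. x \<in> fst T}"

definition adjoint_graph :: "'a::real_inner set \<Rightarrow> 'a partial_op \<Rightarrow> ('a \<times> 'a) set" where
  "adjoint_graph K T = {(v, w). v \<in> K \<and> w \<in> K \<and> (\<forall>x\<in>fst T. inner (snd T x) v = inner x w)}"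

definition selfadjoint_on :: "'a::real_inner set \<Rightarrow> 'a partial_op \<Rightarrow> bool" where
  "selfadjoint_on K T \<longleftrightarrow>
     subspace (fst T) \<and> fst T \<subseteq> K \<and> K \<subseteq> closure (fst T) \<and>
     linear_between (fst T) K (snd T) \<and> op_graph T = adjoint_graph K T"

definition M00 :: "'a::real_inner set \<Rightarrow> 'a set \<Rightarrow> 'a set" where "M00 M N = M \<inter> N"
definition M01 :: "'a::real_inner set \<Rightarrow> 'a set \<Rightarrow> 'a set" where "M01 M N = M \<inter> N\<^sup>\<bottom>"
definition M10 :: "'a::real_inner set \<Rightarrow> 'a set \<Rightarrow> 'a set" where "M10 M N = M\<^sup>\<bottom> \<inter> N"
definition M11 :: "'a::real_inner set \<Rightarrow> 'a set \<Rightarrow> 'a set" where "M11 M N = M\<^sup>\<bottom> \<inter> N\<^sup>\<bottom>"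

definition M0 :: "'a::real_inner set \<Rightarrow> 'a set \<Rightarrow> 'a set" where
  "M0 M N = M \<inter> (M00 M N + M01 M N)\<^sup>\<bottom>"
definition M1 :: "'a::real_inner set \<Rightarrow> 'a set \<Rightarrow> 'a set" where
  "M1 M N = M\<^sup>\<bottom> \<inter> (M10 M N + M11 M N)\<^sup>\<bottom>"

definition N_zero :: "'a::real_inner set \<Rightarrow> 'a set \<Rightarrow> 'a set" where "N_zero M N = M00 M N"
definition N_inf :: "'a::real_inner set \<Rightarrow> 'a set \<Rightarrow> 'a set" where "N_inf M N = M10 M N"
definition N_sharp :: "'a::real_inner set \<Rightarrow> 'a set \<Rightarrow> 'a set" where
  "N_sharp M N = N \<inter> (N_zero M N + N_inf M N)\<^sup>\<bottom>"

type_synonym 'a bifredholm = "'a partial_op \<times> 'a partial_op"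

definition represents :: "'a::real_inner set \<Rightarrow> ('a \<Rightarrow> 'a) \<Rightarrow> 'a set \<Rightarrow> 'a bifredholm \<Rightarrow> bool" where
  "represents M U N T \<longleftrightarrow>
     selfadjoint_on (M0 M N + M00 M N) (fst T) \<and>
     selfadjoint_on (M1 M N + M10 M N) (snd T) \<and>
     N_sharp M N + N_zero M N = {U (snd (fst T) x) + x | x. x \<in> fst (fst T)} \<and>
     N_sharp M N + N_inf M N = {y + adj M U (snd (snd T) y) | y. y \<in> fst (snd T)}"

definition eigenvalue :: "'a::real_vector bifredholm \<Rightarrow> real \<Rightarrow> bool" where
  "eigenvalue T l \<longleftrightarrow> (\<exists>x\<in>fst (fst T). x \<noteq> 0 \<and> snd (fst T) x = l *\<^sub>R x)"

text \<open>The infinite eigenvalue of the bi-Fredholm operator represented by \<open>N\<close>; its eigenvectors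
  are read off from the graph \<open>N\<close>.\<close>

definition infinite_eigenvalue :: "'a::real_inner set \<Rightarrow> 'a set \<Rightarrow> bool" where
  "infinite_eigenvalue M N \<longleftrightarrow> N_inf M N \<noteq> {0}"


section \<open>The one-parameter groups are subgroups, and representing operators exist\<close>

lemma matrix_mult_2:
  fixes a b c d a' b' c' d' :: real
  shows "(vector [vector [a, b], vector [c, d]] :: real^2^2) ** (vector [vector [a', b'], vector [c', d']] :: real^2^2) =
    vector [vector [a * a' + b * c', a * b' + b * d'], vector [c * a' + d * c', c * b' + d * d']]"
  by (simp add: vec_eq_iff forall_2 matrix_matrix_mult_def sum_2)

lemma mat_1_2: "(mat 1 :: real^2^2) = vector [vector [1, 0], vector [0, 1]]"
  by (simp add: vec_eq_iff forall_2 mat_def)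

lemma N_fin_subgroup:
  shows "N_fin l \<subseteq> SL2" and "mat 1 \<in> N_fin l"
    and "g \<in> N_fin l \<Longrightarrow> h \<in> N_fin l \<Longrightarrow> g ** h \<in> N_fin l"
    and "g \<in> N_fin l \<Longrightarrow> \<exists>h\<in>N_fin l. g ** h = mat 1 \<and> h ** g = mat 1"
proof -
  define m where "m t = (vector [vector [1 - l * t, l\<^sup>2 * t], vector [- t, 1 + l * t]] :: real^2^2)" for t
  have N: "N_fin l = range m"
    by (auto simp: N_fin_def m_def)
  have mult: "m s ** m t = m (s + t)" for s t
    unfolding m_def matrix_mult_2 by (simp add: vec_eq_iff forall_2 algebra_simps power2_eq_square)
  have one: "m 0 = mat 1"
    by (simp add: m_def mat_1_2)
  show "N_fin l \<subseteq> SL2"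
    by (auto simp: N SL2_def m_def det_2 algebra_simps power2_eq_square)
  show "mat 1 \<in> N_fin l"
    by (metis N one rangeI)
  show "g \<in> N_fin l \<Longrightarrow> h \<in> N_fin l \<Longrightarrow> g ** h \<in> N_fin l"
    by (auto simp: N mult)
  show "\<exists>h\<in>N_fin l. g ** h = mat 1 \<and> h ** g = mat 1" if g: "g \<in> N_fin l"
  proof -
    obtain t where "g = m t" using g by (auto simp: N)
    then have "g ** m (- t) = mat 1 \<and> m (- t) ** g = mat 1"
      by (simp add: mult one)
    then show ?thesis by (auto simp: N)
  qed
qed

lemma N_sh_subgroup:
  shows "N_sh \<subseteq> SL2" and "mat 1 \<in> N_sh"
    and "g \<in> N_sh \<Longrightarrow> h \<in> N_sh \<Longrightarrow> g ** h \<in> N_sh"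
    and "g \<in> N_sh \<Longrightarrow> \<exists>h\<in>N_sh. g ** h = mat 1 \<and> h ** g = mat 1"
proof -
  define m where "m t = (vector [vector [1, t], vector [0, 1]] :: real^2^2)" for t
  have N: "N_sh = range m"
    by (auto simp: N_sh_def m_def)
  have mult: "m s ** m t = m (s + t)" for s t
    unfolding m_def matrix_mult_2 by (simp add: vec_eq_iff forall_2 algebra_simps)
  have one: "m 0 = mat 1"
    by (simp add: m_def mat_1_2)
  show "N_sh \<subseteq> SL2"
    by (auto simp: N SL2_def m_def det_2)
  show "mat 1 \<in> N_sh"
    by (metis N one rangeI)
  show "g \<in> N_sh \<Longrightarrow> h \<in> N_sh \<Longrightarrow> g ** h \<in> N_sh"
    by (auto simp: N mult)
  show "\<exists>h\<in>N_sh. g ** h = mat 1 \<and> h ** g = mat 1" if g: "g \<in> N_sh"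
  proof -
    obtain t where "g = m t" using g by (auto simp: N)
    then have "g ** m (- t) = mat 1 \<and> m (- t) ** g = mat 1"
      by (simp add: mult one)
    then show ?thesis by (auto simp: N)
  qed
qed

lemma in_comp: "x \<in> W\<^sup>\<bottom> \<longleftrightarrow> (\<forall>y\<in>W. inner y x = 0)"
  by (simp add: orthogonal_comp_def orthogonal_def)

lemma closed_comp: "closed (W\<^sup>\<bottom>)"
proof -
  have "W\<^sup>\<bottom> = (\<Inter>y\<in>W. {x. inner y x = 0})"
    by (auto simp: in_comp)
  then show ?thesis
    by (auto intro!: closed_INT closed_Collect_eq continuous_intros)
qed

lemma projection_exists:
  fixes M :: "'a::{real_inner, complete_space} set"
  assumes "subspace M" "closed M"
  shows "\<exists>x\<in>M. z - x \<in> M\<^sup>\<bottom>"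
proof -
  define d where "d = Inf ((\<lambda>x. (norm (z - x))\<^sup>2) ` M)"
  have ne: "M \<noteq> {}" using assms subspace_0 by blast
  have bdd: "bdd_below ((\<lambda>x. (norm (z - x))\<^sup>2) ` M)"
    by (rule bdd_belowI[of _ 0]) auto
  have dle: "d \<le> (norm (z - x))\<^sup>2" if "x \<in> M" for x
    unfolding d_def using that bdd by (auto intro: cInf_lower)
  have "\<exists>x\<in>M. (norm (z - x))\<^sup>2 < d + e" if "e > 0" for e
    using cInf_lessD[of "(\<lambda>x. (norm (z - x))\<^sup>2) ` M" "d + e"] ne that by (auto simp: d_def)
  then have "\<forall>n. \<exists>x\<in>M. (norm (z - x))\<^sup>2 < d + 1 / Suc n"
    by simp
  then obtain X where XM: "\<And>n. X n \<in> M" and X: "\<And>n. (norm (z - X n))\<^sup>2 < d + 1 / Suc n"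
    by metis
  have par: "(norm (x - y))\<^sup>2 \<le> 2 * (norm (z - x))\<^sup>2 + 2 * (norm (z - y))\<^sup>2 - 4 * d"
    if "x \<in> M" "y \<in> M" for x y
  proof -
    have "(1/2) *\<^sub>R (x + y) \<in> M"
      using assms that by (simp add: subspace_add subspace_scale)
    from dle[OF this] have "4 * d \<le> 4 * (norm (z - (1/2) *\<^sub>R (x + y)))\<^sup>2" by simp
    also have "\<dots> = 2 * (norm (z - x))\<^sup>2 + 2 * (norm (z - y))\<^sup>2 - (norm (x - y))\<^sup>2"
      by (simp add: power2_norm_eq_inner algebra_simps inner_commute)
    finally show ?thesis by simp
  qed
  have "Cauchy X"
  proof (rule metric_CauchyI)
    fix e :: real assume "e > 0"
    then obtain k :: nat where k: "1 / Suc k < e\<^sup>2 / 4"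
      by (metis nat_approx_posE zero_less_divide_iff zero_less_numeral zero_less_power)
    have "dist (X m) (X n) < e" if "m \<ge> k" "n \<ge> k" for m n
    proof -
      have le: "1 / real (Suc j) \<le> 1 / Suc k" if "j \<ge> k" for j
        using that by (simp add: frac_le)
      have "(norm (X m - X n))\<^sup>2 \<le> 2 * (norm (z - X m))\<^sup>2 + 2 * (norm (z - X n))\<^sup>2 - 4 * d"
        using par XM by blast
      also have "\<dots> < e\<^sup>2"
        using X[of m] X[of n] le[OF that(1)] le[OF that(2)] k by linarith
      finally show ?thesis
        using \<open>e > 0\<close> by (simp add: dist_norm power2_less_imp_less)
    qed
    then show "\<exists>K. \<forall>m\<ge>K. \<forall>n\<ge>K. dist (X m) (X n) < e" by blast
  qed
  then obtain x where lim: "X \<longlonglongrightarrow> x"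
    using Cauchy_convergent convergent_def by blast
  have xM: "x \<in> M"
    using closed_sequentially[OF assms(2)] XM lim by blast
  have "(\<lambda>n. d + 1 / Suc n) \<longlonglongrightarrow> d + 0"
    by (intro tendsto_add tendsto_const LIMSEQ_Suc[OF lim_1_over_n])
  moreover have "(\<lambda>n. (norm (z - X n))\<^sup>2) \<longlonglongrightarrow> (norm (z - x))\<^sup>2"
    by (intro tendsto_intros lim)
  ultimately have min: "(norm (z - x))\<^sup>2 \<le> d"
    using X by (metis (no_types, lifting) LIMSEQ_le add.right_neutral less_imp_le)
  have "inner y (z - x) = 0" if "y \<in> M" for y
  proof (cases "y = 0")
    case False
    define c where "c = inner y (z - x) / inner y y"
    have "x + c *\<^sub>R y \<in> M"
      using assms that xM by (simp add: subspace_add subspace_scale)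
    from dle[OF this] min have "(norm (z - x))\<^sup>2 \<le> (norm (z - (x + c *\<^sub>R y)))\<^sup>2" by linarith
    also have "\<dots> = (norm (z - x))\<^sup>2 - (2 * c * inner y (z - x) - c\<^sup>2 * inner y y)"
      unfolding power2_norm_eq_inner by (simp add: algebra_simps inner_commute power2_eq_square)
    also have "2 * c * inner y (z - x) - c\<^sup>2 * inner y y = (inner y (z - x))\<^sup>2 / inner y y"
      using False by (simp add: c_def power2_eq_square field_simps)
    finally have "(inner y (z - x))\<^sup>2 / inner y y \<le> 0" by simp
    moreover have "inner y y > 0" using False by simp
    ultimately show ?thesis by (auto simp: divide_le_0_iff)
  qed simp
  then show ?thesis using xM by (auto simp: in_comp)
qed

lemma proj_unique:
  fixes M :: "'a::real_inner set"
  assumes "subspace M" "x \<in> M" "z - x \<in> M\<^sup>\<bottom>"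
  shows "proj M z = x"
  unfolding proj_def
proof (rule the_equality)
  fix x' assume "x' \<in> M \<and> z - x' \<in> M\<^sup>\<bottom>"
  then have "inner (x - x') (z - x') = 0" "inner (x - x') (z - x) = 0"
    using assms by (auto simp: in_comp subspace_diff)
  then have "inner (x - x') (x - x') = 0"
    by (simp add: algebra_simps)
  then show "x' = x" by simp
qed (use assms in auto)

lemma proj_props:
  fixes M :: "'a::{real_inner, complete_space} set"
  assumes "subspace M" "closed M"
  shows "proj M z \<in> M" "z - proj M z \<in> M\<^sup>\<bottom>"
  using projection_exists[OF assms, of z] proj_unique[OF assms(1)] by metis+

lemma comp_comp:
  fixes M :: "'a::{real_inner, complete_space} set"
  assumes "subspace M" "closed M"
  shows "M\<^sup>\<bottom>\<^sup>\<bottom> = M"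
proof
  show "M\<^sup>\<bottom>\<^sup>\<bottom> \<subseteq> M"
  proof
    fix z assume z: "z \<in> M\<^sup>\<bottom>\<^sup>\<bottom>"
    have p: "proj M z \<in> M" "z - proj M z \<in> M\<^sup>\<bottom>"
      using proj_props[OF assms] by auto
    then have "inner (z - proj M z) z = 0" "inner (proj M z) (z - proj M z) = 0"
      using z by (auto simp: in_comp)
    then have "inner (z - proj M z) (z - proj M z) = 0"
      by (simp add: algebra_simps inner_commute)
    then show "z \<in> M" using p(1) by simp
  qed
qed (rule orthogonal_comp_subset)

lemma proj_sum:
  fixes M :: "'a::{real_inner, complete_space} set"
  assumes "subspace M" "closed M" "x \<in> M" "y \<in> M\<^sup>\<bottom>"
  shows "proj M (y + x) = x" "proj (M\<^sup>\<bottom>) (y + x) = y"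
proof -
  show "proj M (y + x) = x"
    by (rule proj_unique) (use assms in auto)
  show "proj (M\<^sup>\<bottom>) (y + x) = y"
    by (rule proj_unique) (use assms comp_comp[OF assms(1,2)] in \<open>auto simp: subspace_orthogonal_comp\<close>)
qed

lemma unitary_inner:
  assumes "subspace M" "unitary_between M M' U" "x \<in> M" "x' \<in> M"
  shows "inner (U x) (U x') = inner x x'"
proof -
  have U: "U (x + x') = U x + U x'" "norm (U (x + x')) = norm (x + x')"
    "norm (U x) = norm x" "norm (U x') = norm x'"
    using assms subspace_add[OF assms(1,3,4)] by (auto simp: unitary_between_def linear_between_def)
  have "(norm (U x + U x'))\<^sup>2 = (norm (x + x'))\<^sup>2" "(norm (U x))\<^sup>2 = (norm x)\<^sup>2" "(norm (U x'))\<^sup>2 = (norm x')\<^sup>2"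
    using U by metis+
  then show ?thesis
    by (simp add: power2_norm_eq_inner algebra_simps inner_commute)
qed

lemma adj_unitary:
  assumes "subspace M" "unitary_between M M' U" "x \<in> M"
  shows "adj M U (U x) = x"
  unfolding adj_def
proof (rule the_equality)
  show "x \<in> M \<and> (\<forall>x'\<in>M. inner (U x') (U x) = inner x' x)"
    using assms unitary_inner by blast
  fix v assume v: "v \<in> M \<and> (\<forall>x'\<in>M. inner (U x') (U x) = inner x' v)"
  then have "inner (v - x) v = inner (v - x) x"
    using assms unitary_inner[OF assms(1,2)] by (metis subspace_diff)
  then have "inner (v - x) (v - x) = 0"
    by (simp add: algebra_simps)
  then show "v = x" by simp
qed

lemma unitary_adj:
  assumes "subspace M" "unitary_between M M' U"
  shows "unitary_between M' M (adj M U)" and "y \<in> M' \<Longrightarrow> U (adj M U y) = y"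
proof -
  have bij: "bij_betw U M M'" using assms(2) by (simp add: unitary_between_def)
  have M': "M' = U ` M" using bij by (simp add: bij_betw_def)
  show "y \<in> M' \<Longrightarrow> U (adj M U y) = y"
    by (auto simp: M' adj_unitary[OF assms])
  have "bij_betw (adj M U) M' M"
    by (rule bij_betw_byWitness[of _ U]) (auto simp: M' adj_unitary[OF assms])
  moreover have "adj M U (U x + U y) = x + y" if "x \<in> M" "y \<in> M" for x y
  proof -
    have "U x + U y = U (x + y)"
      using assms(2) that by (simp add: unitary_between_def linear_between_def)
    then show ?thesis
      using assms(1) that by (simp add: adj_unitary[OF assms] subspace_add)
  qed
  moreover have "adj M U (c *\<^sub>R U x) = c *\<^sub>R x" if "x \<in> M" for x c
  proof -
    have "c *\<^sub>R U x = U (c *\<^sub>R x)"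
      using assms(2) that by (simp add: unitary_between_def linear_between_def)
    then show ?thesis
      using assms(1) that by (simp add: adj_unitary[OF assms] subspace_scale)
  qed
  moreover have "norm (x) = norm (U x)" if "x \<in> M" for x
    using assms(2) that by (simp add: unitary_between_def)
  ultimately show "unitary_between M' M (adj M U)"
    unfolding unitary_between_def linear_between_def M'
    by (auto simp: adj_unitary[OF assms])
qed

lemma adj_adj:
  assumes "subspace M" "subspace M'" "unitary_between M M' U" "x \<in> M"
  shows "adj M' (adj M U) x = U x"
  using adj_unitary[OF assms(2) unitary_adj(1)[OF assms(1,3)], of "U x"] adj_unitary[OF assms(1,3,4)] assms(3,4)
  by (auto simp: unitary_between_def linear_between_def)

lemma closed_comp_part:
  fixes K :: "'a::{real_inner, complete_space} set"
  assumes "subspace A" "closed A" "subspace B" "\<And>a b. a \<in> A \<Longrightarrow> b \<in> B \<Longrightarrow> inner a b = 0"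
    "subspace K" "A \<subseteq> K"
  shows "K \<inter> (A + B)\<^sup>\<bottom> + A = K \<inter> B\<^sup>\<bottom>"
proof (intro equalityI subsetI)
  fix z assume "z \<in> K \<inter> (A + B)\<^sup>\<bottom> + A"
  then obtain u a where z: "z = u + a" and u: "u \<in> K" "u \<in> (A + B)\<^sup>\<bottom>" and a: "a \<in> A"
    by (auto elim: set_plus_elim)
  have "inner b u = 0" if "b \<in> B" for b
    using u(2) set_plus_intro[OF subspace_0[OF assms(1)] that] by (simp add: in_comp)
  then show "z \<in> K \<inter> B\<^sup>\<bottom>"
  proof -
    assume *: "\<And>b. b \<in> B \<Longrightarrow> inner b u = 0"
    have "inner b z = 0" if "b \<in> B" for b
      using *[OF that] assms(4)[OF a that] by (simp add: z inner_add_right inner_commute[of b a])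
    then show "z \<in> K \<inter> B\<^sup>\<bottom>"
      using z u(1) a assms(5,6) by (auto simp: in_comp intro: subspace_add)
  qed
next
  fix z assume z: "z \<in> K \<inter> B\<^sup>\<bottom>"
  define a where "a = proj A z"
  have a: "a \<in> A" "z - a \<in> A\<^sup>\<bottom>" using proj_props[OF assms(1,2)] by (auto simp: a_def)
  have "z - a \<in> K" using z a assms(5,6) by (auto intro: subspace_diff)
  moreover have "z - a \<in> (A + B)\<^sup>\<bottom>"
    unfolding in_comp
  proof
    fix v assume "v \<in> A + B"
    then obtain p q where v: "v = p + q" "p \<in> A" "q \<in> B" by (rule set_plus_elim)
    have "inner p (z - a) = 0" using a(2) v(2) by (simp add: in_comp)
    moreover have "inner q z = 0" using z v(3) by (simp add: in_comp)
    moreover have "inner q a = 0" using assms(4)[OF a(1) v(3)] by (simp add: inner_commute)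
    ultimately show "inner v (z - a) = 0" by (simp add: v(1) inner_add_left inner_diff_right)
  qed
  ultimately have "(z - a) + a \<in> K \<inter> (A + B)\<^sup>\<bottom> + A"
    using a by (intro set_plus_intro) auto
  then show "z \<in> K \<inter> (A + B)\<^sup>\<bottom> + A" by simp
qed

lemma subspace_closure:
  fixes D :: "'a::real_normed_vector set"
  assumes "subspace D"
  shows "subspace (closure D)"
  unfolding subspace_def
proof (intro conjI ballI allI)
  show "0 \<in> closure D"
    using subspace_0[OF assms] closure_subset by blast
  fix x assume "x \<in> closure D"
  then obtain X where X: "\<And>n. X n \<in> D" "X \<longlonglongrightarrow> x"
    by (auto simp: closure_sequential)
  show "c *\<^sub>R x \<in> closure D" for c
    unfolding closure_sequential
    by (rule exI[of _ "\<lambda>n. c *\<^sub>R X n"]) (use X assms in \<open>auto intro: subspace_scale tendsto_intros\<close>)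
  fix y assume "y \<in> closure D"
  then obtain Y where Y: "\<And>n. Y n \<in> D" "Y \<longlonglongrightarrow> y"
    by (auto simp: closure_sequential)
  show "x + y \<in> closure D"
    unfolding closure_sequential
    by (rule exI[of _ "\<lambda>n. X n + Y n"]) (use X Y assms in \<open>auto intro: subspace_add tendsto_intros\<close>)
qed

lemma symp_sum:
  fixes M :: "'a::{real_inner, complete_space} set"
  assumes "subspace M" "closed M" "x \<in> M" "y \<in> M\<^sup>\<bottom>" "x' \<in> M" "y' \<in> M\<^sup>\<bottom>"
  shows "symp M U (y + x) (y' + x') = inner (U x) y' - inner (adj M U y) x'"
  by (simp add: symp_def proj_sum assms)

lemma adj_inner:
  assumes "subspace M" "unitary_between M M' U" "x \<in> M" "y \<in> M'"
  shows "inner (U x) y = inner x (adj M U y)" and "adj M U y \<in> M"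
proof -
  show "adj M U y \<in> M"
    using unitary_adj(1)[OF assms(1,2)] assms(4) by (auto simp: unitary_between_def linear_between_def)
  then show "inner (U x) y = inner x (adj M U y)"
    using unitary_inner[OF assms(1,2,3)] unitary_adj(2)[OF assms(1,2,4)] by metis
qed

lemma op_exists:
  fixes M N :: "'a::{real_inner, complete_space} set"
  assumes M: "subspace M" "closed M" and U: "unitary_between M (M\<^sup>\<bottom>) U" and L: "lagrangian M U N"
  shows "\<exists>T. selfadjoint_on (M0 M N + M00 M N) T \<and>
     N_sharp M N + N_zero M N = {U (snd T x) + x | x. x \<in> fst T}"
proof -
  define V where "V = adj M U"
  have UM: "U x \<in> M\<^sup>\<bottom>" if "x \<in> M" for x
    using U that by (auto simp: unitary_between_def linear_between_def)
  note M' = subspace_orthogonal_comp[of M]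
  have VU: "V (U x) = x" if "x \<in> M" for x
    using adj_unitary[OF M(1) U that] by (simp add: V_def)
  have VM: "V y \<in> M" and UV: "U (V y) = y" if "y \<in> M\<^sup>\<bottom>" for y
    using adj_inner(2)[OF M(1) U _ that] unitary_adj(2)[OF M(1) U that] M(1) subspace_0 by (auto simp: V_def)
  have UVi: "inner (U x) y = inner x (V y)" if "x \<in> M" "y \<in> M\<^sup>\<bottom>" for x y
    using adj_inner(1)[OF M(1) U that] by (simp add: V_def)
  have Vlin: "V (y + y') = V y + V y'" "V (c *\<^sub>R y) = c *\<^sub>R V y" if "y \<in> M\<^sup>\<bottom>" "y' \<in> M\<^sup>\<bottom>" for y y' c
    using unitary_adj(1)[OF M(1) U] that by (auto simp: unitary_between_def linear_between_def V_def)
  have sN: "subspace N" using L by (simp add: lagrangian_def)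
  have dec: "\<exists>y\<in>M\<^sup>\<bottom>. \<exists>x\<in>M. z = y + x" for z
    using proj_props[OF M, of z] by (metis diff_add_cancel)
  have orth: "inner x y = 0" "inner y x = 0" if "x \<in> M" "y \<in> M\<^sup>\<bottom>" for x y
    using that by (auto simp: in_comp inner_commute)
  have sy: "inner (U x) y' = inner (V y) x'"
    if "y + x \<in> N" "y' + x' \<in> N" "x \<in> M" "y \<in> M\<^sup>\<bottom>" "x' \<in> M" "y' \<in> M\<^sup>\<bottom>" for x y x' y'
  proof -
    have "symp M U (y + x) (y' + x') = 0"
      using L that(1,2) by (auto simp: lagrangian_def symp_comp_def)
    then show ?thesis using symp_sum[OF M, of x y x' y' U] that by (simp add: V_def)
  qed
  have inN: "y + x \<in> N" if xy: "x \<in> M" "y \<in> M\<^sup>\<bottom>"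
    and hyp: "\<And>x' y'. y' + x' \<in> N \<Longrightarrow> x' \<in> M \<Longrightarrow> y' \<in> M\<^sup>\<bottom> \<Longrightarrow> inner (U x) y' = inner (V y) x'" for x y
  proof -
    have "symp M U (y + x) z = 0" if z: "z \<in> N" for z
    proof -
      obtain y' x' where "y' \<in> M\<^sup>\<bottom>" "x' \<in> M" "z = y' + x'" using dec by blast
      then show ?thesis using symp_sum[OF M xy, of x' y' U] hyp[of y' x'] z by (simp add: V_def)
    qed
    then show ?thesis using L by (auto simp: lagrangian_def symp_comp_def)
  qed
  define J where "J z = U (proj M z) - V (proj (M\<^sup>\<bottom>) z)" for z
  have sJ: "symp M U z z' = - inner z (J z')" for z z'
  proof -
    obtain y x y' x' where *: "y \<in> M\<^sup>\<bottom>" "x \<in> M" "z = y + x" "y' \<in> M\<^sup>\<bottom>" "x' \<in> M" "z' = y' + x'"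
      using dec by metis
    have "inner x (U x') = 0" "inner y (V y') = 0" "inner (V y) x' = inner y (U x')" "inner (U x) y' = inner x (V y')"
      using UVi[OF *(2,4)] UVi[OF *(5,1)] orth(1)[OF *(2) UM[OF *(5)]] orth(2)[OF VM[OF *(4)] *(1)]
      by (simp_all add: inner_commute)
    then have "inner (y + x) (U x' - V y') = inner (V y) x' - inner (U x) y'"
      by (simp add: algebra_simps)
    then show ?thesis using * by (simp add: symp_sum[OF M] proj_sum[OF M] J_def V_def)
  qed
  have clN: "closed N"
  proof -
    have "symp_comp M U N = (J ` N)\<^sup>\<bottom>"
      by (auto simp: symp_comp_def sJ in_comp inner_commute)
    then have "N = (J ` N)\<^sup>\<bottom>"
      using L by (simp add: lagrangian_def)
    then show ?thesis using closed_comp[of "J ` N"] by simp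
  qed
  define Z where "Z = M\<^sup>\<bottom> \<inter> N"
  have sZ: "subspace Z" "closed Z"
    by (auto simp: Z_def M' sN clN closed_comp subspace_inter)
  define K where "K = M \<inter> (M \<inter> N\<^sup>\<bottom>)\<^sup>\<bottom>"
  have sK: "subspace K" "closed K"
    by (auto simp: K_def M closed_comp subspace_orthogonal_comp subspace_inter)
  have K: "M0 M N + M00 M N = K"
    unfolding M0_def M00_def M01_def K_def
    by (rule closed_comp_part)
      (use M sN clN in \<open>auto simp: subspace_inter subspace_orthogonal_comp in_comp\<close>)
  have NN: "N_sharp M N + N_zero M N = N \<inter> Z\<^sup>\<bottom>"
    unfolding N_sharp_def N_zero_def N_inf_def M00_def M10_def Z_def
    by (rule closed_comp_part)
      (use M sN clN M' orth in \<open>auto simp: subspace_inter\<close>)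
  have VZ: "V n \<in> M \<inter> N\<^sup>\<bottom>" if "n \<in> Z" for n
  proof -
    have n: "n \<in> N" "n \<in> M\<^sup>\<bottom>" using that by (auto simp: Z_def)
    have "inner z (V n) = 0" if z: "z \<in> N" for z
    proof -
      obtain y x where *: "y \<in> M\<^sup>\<bottom>" "x \<in> M" "z = y + x" using dec by blast
      have "inner (V n) x = 0"
        using sy[of n 0 y x] n * z M subspace_0 UVi[of 0 y] VM by auto
      moreover have "inner y (V n) = 0" using * VM n orth by blast
      ultimately show ?thesis using * by (simp add: algebra_simps inner_commute)
    qed
    then show ?thesis using VM n by (auto simp: in_comp)
  qed
  have UZ: "U m \<in> Z" if "m \<in> M" "m \<in> N\<^sup>\<bottom>" for m
  proof -
    have "U m + 0 \<in> N"
    proof (rule inN)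
      fix x' y' assume *: "y' + x' \<in> N" "x' \<in> M" "y' \<in> M\<^sup>\<bottom>"
      have "inner (y' + x') m = 0" using that(2) * by (auto simp: in_comp)
      then have "inner x' m = 0" using orth(2)[OF that(1) *(3)] by (simp add: algebra_simps)
      moreover have "inner (U 0) y' = 0" using UVi[of 0 y'] * M subspace_0 by auto
      ultimately show "inner (U 0) y' = inner (V (U m)) x'"
        using VU that by (simp add: inner_commute)
    qed (use M subspace_0 UM that in auto)
    then show ?thesis using UM that by (simp add: Z_def)
  qed
  define D where "D = {x\<in>M. \<exists>y\<in>M\<^sup>\<bottom>. y + x \<in> N}"
  have ex: "\<exists>y. y \<in> M\<^sup>\<bottom> \<and> y \<in> Z\<^sup>\<bottom> \<and> y + x \<in> N" if "x \<in> D" for x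
  proof -
    obtain y where y: "y \<in> M\<^sup>\<bottom>" "y + x \<in> N" using \<open>x \<in> D\<close> by (auto simp: D_def)
    have p: "proj Z y \<in> Z" "y - proj Z y \<in> Z\<^sup>\<bottom>" using proj_props[OF sZ] by auto
    then have "y - proj Z y \<in> M\<^sup>\<bottom>" using y M' by (auto simp: Z_def subspace_diff)
    moreover have "(y + x) - proj Z y \<in> N" using p(1) y sN by (auto simp: Z_def subspace_diff)
    then have "(y - proj Z y) + x \<in> N" by (simp add: algebra_simps)
    ultimately show ?thesis using p by blast
  qed
  have uni: "y = y'" if "y \<in> M\<^sup>\<bottom>" "y \<in> Z\<^sup>\<bottom>" "y + x \<in> N" "y' \<in> M\<^sup>\<bottom>" "y' \<in> Z\<^sup>\<bottom>" "y' + x \<in> N" for x y y'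
  proof -
    have "(y + x) - (y' + x) \<in> N" using that sN subspace_diff by blast
    then have "y - y' \<in> Z" using that M' by (auto simp: Z_def subspace_diff)
    moreover have "y - y' \<in> Z\<^sup>\<bottom>" using that subspace_orthogonal_comp subspace_diff by blast
    ultimately have "inner (y - y') (y - y') = 0" by (simp only: in_comp)
    then show ?thesis by simp
  qed
  define Y where "Y x = (SOME y. y \<in> M\<^sup>\<bottom> \<and> y \<in> Z\<^sup>\<bottom> \<and> y + x \<in> N)" for x
  have Y: "Y x \<in> M\<^sup>\<bottom>" "Y x \<in> Z\<^sup>\<bottom>" "Y x + x \<in> N" if "x \<in> D" for x
    using someI_ex[OF ex[OF that]] by (auto simp: Y_def)
  have Yeq: "Y x = y" if "x \<in> M" "y \<in> M\<^sup>\<bottom>" "y \<in> Z\<^sup>\<bottom>" "y + x \<in> N" for x y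
    using uni[OF Y[of x]] that by (auto simp: D_def)
  have DM: "D \<subseteq> M" by (auto simp: D_def)
  have sD: "subspace D"
    unfolding subspace_def
  proof (intro conjI ballI allI)
    show "0 \<in> D" using M sN M' by (auto simp: D_def subspace_0 intro!: bexI[of _ 0])
    fix x x' assume x: "x \<in> D" "x' \<in> D"
    have "(Y x + x) + (Y x' + x') \<in> N" using Y x sN subspace_add by blast
    then have "(Y x + Y x') + (x + x') \<in> N" by (simp add: algebra_simps)
    then show "x + x' \<in> D" using x Y M' M DM by (auto simp: D_def intro: subspace_add)
  next
    fix c x assume x: "x \<in> D"
    have "c *\<^sub>R (Y x + x) \<in> N" using Y x sN subspace_scale by blast
    then have "c *\<^sub>R Y x + c *\<^sub>R x \<in> N" by (simp add: algebra_simps)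
    then show "c *\<^sub>R x \<in> D" using x Y M' M DM by (auto simp: D_def intro: subspace_scale)
  qed
  have Yadd: "Y (x + x') = Y x + Y x'" if "x \<in> D" "x' \<in> D" for x x'
  proof (rule Yeq)
    have "(Y x + x) + (Y x' + x') \<in> N" using Y that sN subspace_add by blast
    then show "(Y x + Y x') + (x + x') \<in> N" by (simp add: algebra_simps)
    show "x + x' \<in> M" using that DM M subspace_add by blast
    show "Y x + Y x' \<in> M\<^sup>\<bottom>" "Y x + Y x' \<in> Z\<^sup>\<bottom>"
      using Y(1,2)[OF that(1)] Y(1,2)[OF that(2)] by (simp_all add: subspace_add[OF subspace_orthogonal_comp])
  qed
  have Yscale: "Y (c *\<^sub>R x) = c *\<^sub>R Y x" if "x \<in> D" for x c
  proof (rule Yeq)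
    have "c *\<^sub>R (Y x + x) \<in> N" using Y that sN subspace_scale by blast
    then show "c *\<^sub>R Y x + c *\<^sub>R x \<in> N" by (simp add: algebra_simps)
    show "c *\<^sub>R x \<in> M" using that DM M subspace_scale by blast
    show "c *\<^sub>R Y x \<in> M\<^sup>\<bottom>" "c *\<^sub>R Y x \<in> Z\<^sup>\<bottom>"
      using Y(1,2)[OF that] by (simp_all add: subspace_scale[OF subspace_orthogonal_comp])
  qed
  define T where "T = (D, \<lambda>x. V (Y x))"
  have graph: "N \<inter> Z\<^sup>\<bottom> = {U (snd T x) + x | x. x \<in> fst T}"
  proof (intro equalityI subsetI)
    fix z assume z: "z \<in> N \<inter> Z\<^sup>\<bottom>"
    obtain y x where *: "y \<in> M\<^sup>\<bottom>" "x \<in> M" "z = y + x" using dec by blast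
    have "y \<in> Z\<^sup>\<bottom>"
      unfolding in_comp
    proof
      fix n assume n: "n \<in> Z"
      then have "inner n (y + x) = 0" using z * by (simp add: in_comp)
      moreover have "inner n x = 0" using orth(2)[OF *(2)] n by (simp add: Z_def)
      ultimately show "inner n y = 0" by (simp add: inner_add_right)
    qed
    then have "Y x = y" using z * Yeq by auto
    then have "z = U (snd T x) + x" using * UV[OF *(1)] by (simp add: T_def)
    moreover have "x \<in> fst T" using z * by (auto simp: D_def T_def)
    ultimately show "z \<in> {U (snd T x) + x | x. x \<in> fst T}"
      by blast
  next
    fix z assume "z \<in> {U (snd T x) + x | x. x \<in> fst T}"
    then obtain x where x: "x \<in> D" "z = Y x + x" using UV Y by (auto simp: T_def)
    have "inner n z = 0" if n: "n \<in> Z" for n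
    proof -
      have "inner n (Y x) = 0" using Y(2)[OF x(1)] n by (simp add: in_comp)
      moreover have "inner n x = 0" using orth(2)[of x n] n x(1) DM by (auto simp: Z_def)
      ultimately show ?thesis by (simp add: x(2) inner_add_right)
    qed
    then show "z \<in> N \<inter> Z\<^sup>\<bottom>" using x(2) Y(3)[OF x(1)] by (simp add: in_comp)
  qed
  have DK: "D \<subseteq> K"
  proof
    fix x assume x: "x \<in> D"
    have "inner m x = 0" if "m \<in> M" "m \<in> N\<^sup>\<bottom>" for m
    proof -
      have "inner (Y x + x) m = 0" using that Y[OF x] by (auto simp: in_comp)
      then show ?thesis using orth(2)[OF that(1) Y(1)[OF x]] by (simp add: algebra_simps inner_commute)
    qed
    then show "x \<in> K" using x DM by (auto simp: K_def in_comp)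
  qed
  have TK: "V (Y x) \<in> K" if x: "x \<in> D" for x
  proof -
    have "inner m (V (Y x)) = 0" if "m \<in> M" "m \<in> N\<^sup>\<bottom>" for m
      using UVi[OF that(1) Y(1)[OF x]] Y(2)[OF x] UZ[OF that] by (auto simp: in_comp)
    then show ?thesis using VM Y x by (auto simp: K_def in_comp)
  qed
  have dense: "K \<subseteq> closure D"
  proof
    fix k assume k: "k \<in> K"
    have c: "subspace (closure D)" "closed (closure D)" using subspace_closure[OF sD] by auto
    define r where "r = k - proj (closure D) k"
    have p: "proj (closure D) k \<in> closure D" "r \<in> (closure D)\<^sup>\<bottom>"
      using proj_props[OF c] by (auto simp: r_def)
    have "closure D \<subseteq> K" using DK sK closure_minimal by blast
    then have rK: "r \<in> K" using p k sK subspace_diff by (auto simp: r_def)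
    have "r \<in> N\<^sup>\<bottom>"
      unfolding in_comp
    proof
      fix z assume z: "z \<in> N"
      obtain y x where *: "y \<in> M\<^sup>\<bottom>" "x \<in> M" "z = y + x" using dec by blast
      then have "x \<in> D" using z by (auto simp: D_def)
      then have "x \<in> closure D" using closure_subset by blast
      then have "inner x r = 0" using p by (auto simp: in_comp)
      moreover have "inner y r = 0" using orth(2)[OF _ *(1)] rK by (simp add: K_def)
      ultimately show "inner z r = 0" by (simp add: *(3) inner_add_left)
    qed
    then have "inner r r = 0" using rK by (auto simp: K_def in_comp)
    then show "k \<in> closure D" using p by (simp add: r_def)
  qed
  have gr: "op_graph T = adjoint_graph K T"
  proof (intro equalityI subsetI)
    fix p assume "p \<in> op_graph T"
    then obtain x where x: "x \<in> D" "p = (x, V (Y x))" by (auto simp: op_graph_def T_def)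
    have "inner (V (Y x')) x = inner x' (V (Y x))" if x': "x' \<in> D" for x'
    proof -
      have m: "x \<in> M" "x' \<in> M" using x(1) x' DM by auto
      then show ?thesis
        using sy[OF Y(3)[OF x'] Y(3)[OF x(1)] m(2) Y(1)[OF x'] m(1) Y(1)[OF x(1)]] UVi[OF m(2) Y(1)[OF x(1)]]
        by simp
    qed
    then show "p \<in> adjoint_graph K T"
      using x DK TK by (auto simp: adjoint_graph_def T_def)
  next
    fix p assume "p \<in> adjoint_graph K T"
    then obtain v w where p: "p = (v, w)" and vK: "v \<in> K" and wK: "w \<in> K"
      and ad: "\<And>x. x \<in> D \<Longrightarrow> inner (V (Y x)) v = inner x w"
      by (auto simp: adjoint_graph_def T_def)
    have vw: "v \<in> M" "w \<in> M" using vK wK by (auto simp: K_def)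
    have N: "U w + v \<in> N"
    proof (rule inN)
      fix x' y' assume *: "y' + x' \<in> N" "x' \<in> M" "y' \<in> M\<^sup>\<bottom>"
      then have x': "x' \<in> D" by (auto simp: D_def)
      have "(y' + x') - (Y x' + x') \<in> N" using * Y x' sN subspace_diff by blast
      then have n: "y' - Y x' \<in> Z" using * Y x' M' by (auto simp: Z_def subspace_diff)
      then have "inner (V (y' - Y x')) v = 0" using VZ vK by (auto simp: K_def in_comp)
      moreover have "V y' = V (y' - Y x') + V (Y x')"
        using Vlin(1)[of "y' - Y x'" "Y x'"] n Y x' by (simp add: Z_def)
      ultimately have "inner (V y') v = inner x' w"
        using ad[OF x'] by (simp add: inner_add_left)
      then show "inner (U v) y' = inner (V (U w)) x'"
        using UVi[OF vw(1) *(3)] VU vw by (simp add: inner_commute)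
    qed (use vw UM in auto)
    have "U w \<in> Z\<^sup>\<bottom>"
      unfolding in_comp
    proof
      fix n assume n: "n \<in> Z"
      have "inner (V n) w = 0" using VZ[OF n] wK by (auto simp: K_def in_comp)
      then show "inner n (U w) = 0" using UVi[of w n] n vw by (auto simp: Z_def inner_commute)
    qed
    then have "Y v = U w" using Yeq vw UM N by auto
    moreover have "v \<in> D" using vw UM N by (auto simp: D_def)
    ultimately show "p \<in> op_graph T" using VU vw by (auto simp: p op_graph_def T_def)
  qed
  have "selfadjoint_on K T"
    unfolding selfadjoint_on_def linear_between_def
    using gr dense DK TK sD Yadd Yscale Vlin(1)[OF Y(1) Y(1)] Vlin(2)[OF Y(1) Y(1)] by (auto simp: T_def)
  then show ?thesis unfolding K NN using graph by blast
qed

theorem represents_exists: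
  fixes M N :: "'a::{real_inner, complete_space} set"
  assumes M: "subspace M" "closed M" and U: "unitary_between M (M\<^sup>\<bottom>) U" and L: "lagrangian M U N"
  shows "\<exists>T. represents M U N T"
proof -
  obtain A where A: "selfadjoint_on (M0 M N + M00 M N) A"
    "N_sharp M N + N_zero M N = {U (snd A x) + x | x. x \<in> fst A}"
    using op_exists[OF assms] by blast
  note M' = subspace_orthogonal_comp[of M] closed_comp[of M] and cc = comp_comp[OF M]
  note V = unitary_adj(1)[OF M(1) U]
  have V': "unitary_between (M\<^sup>\<bottom>) (M\<^sup>\<bottom>\<^sup>\<bottom>) (adj M U)"
    using V by (simp only: cc)
  have "symp (M\<^sup>\<bottom>) (adj M U) z z' = - symp M U z z'" for z z'
  proof -
    have "proj M z \<in> M" using proj_props[OF M] by blast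
    then show ?thesis by (simp add: symp_def cc adj_adj[OF M(1) M'(1) U])
  qed
  then have "lagrangian (M\<^sup>\<bottom>) (adj M U) N"
    using L by (simp add: lagrangian_def symp_comp_def)
  then obtain B where B: "selfadjoint_on (M0 (M\<^sup>\<bottom>) N + M00 (M\<^sup>\<bottom>) N) B"
    "N_sharp (M\<^sup>\<bottom>) N + N_zero (M\<^sup>\<bottom>) N = {adj M U (snd B x) + x | x. x \<in> fst B}"
    using op_exists[OF M' V'] by blast
  have "M0 (M\<^sup>\<bottom>) N = M1 M N" "M00 (M\<^sup>\<bottom>) N = M10 M N" "N_zero (M\<^sup>\<bottom>) N = N_inf M N"
    "N_sharp (M\<^sup>\<bottom>) N = N_sharp M N"
    by (simp_all add: M0_def M1_def M00_def M10_def M01_def M11_def N_zero_def N_inf_def N_sharp_def cc add.commute)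
  with A B have "represents M U N (A, B)"
    by (simp add: represents_def add.commute)
  then show ?thesis by blast
qed

end

theory Submission
  imports Defs
begin

text \<open>
  Each of the two one-parameter groups acts on the Hilbert space by \<open>z \<mapsto> z + t *\<^sub>R n z\<close> with
  \<open>t\<close> real, where \<open>n\<close> is a linear operator with \<open>n \<circ> n = 0\<close>.  As the inverse of such a map is
  obtained by replacing \<open>t\<close> with \<open>- t\<close>, a vector \<open>z\<close> lies in all the images of \<open>N\<close> if and only
  if the whole line of the vectors \<open>z + t *\<^sub>R n z\<close> lies in \<open>N\<close>, that is, if \<open>z\<close> and \<open>n z\<close> are both
  in \<open>N\<close>.  If such a \<open>z\<close> is non-zero, then either \<open>z\<close> itself is a non-zero vector of \<open>N\<close> killed by
  \<open>n\<close>, or \<open>n z\<close> is one, because \<open>n\<close> squares to zero.  Conversely the group fixes the vectors of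
  the kernel.  So the intersection is non-zero if and only if \<open>N\<close> meets the kernel of \<open>n\<close>
  non-trivially (\<open>Inter_shear_images_nonzero_iff\<close>).

  The kernels are where the eigenvectors live.  For the group of a real number \<open>l\<close> the kernel is
  the graph \<open>{(l U x, x)}\<close> of the scalar operator \<open>l\<close>; for the group of upper triangular matrices
  it is \<open>M\<^sup>\<bottom>\<close>, whose intersection with \<open>N\<close> is by definition the space of eigenvectors for the
  infinite eigenvalue.

  For real \<open>l\<close> there remains the passage from vectors \<open>(l U x, x)\<close> of \<open>N\<close> to eigenvectors of the
  represented operator, whose graph is only the part of \<open>N\<close> orthogonal to \<open>M\<^sup>\<bottom> \<inter> N\<close>.  Here the
  isotropy of \<open>N\<close> enters: pairing \<open>(l U x, x)\<close> with \<open>(y, 0)\<close> in \<open>N\<close> gives that \<open>U x\<close> is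
  orthogonal to \<open>y\<close>, so \<open>(l U x, x)\<close> lies in that part automatically
  (\<open>eigenvalue_iff_scalar_graph_meets\<close>).
\<close>

section \<open>Shears along a square-zero operator\<close>

lemma mem_Inter_shear_images_iff:
  fixes n :: "'a::real_vector \<Rightarrow> 'a"
  assumes n: "linear n" and sq: "\<And>z. n (n z) = 0" and N: "subspace N"
  shows "z \<in> (\<Inter>t::real. (\<lambda>z. z + t *\<^sub>R n z) ` N) \<longleftrightarrow> z \<in> N \<and> n z \<in> N"
proof
  assume z: "z \<in> (\<Inter>t::real. (\<lambda>z. z + t *\<^sub>R n z) ` N)"
  have "z \<in> (\<lambda>z. z + 0 *\<^sub>R n z) ` N" "z \<in> (\<lambda>z. z + 1 *\<^sub>R n z) ` N"
    using z by blast+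
  then obtain v where v: "v \<in> N" "z = v + n v" and zN: "z \<in> N"
    by auto
  have "n z = n v"
    using v(2) by (simp add: linear_add[OF n] sq)
  then have "n z = z - v"
    using v(2) by simp
  then show "z \<in> N \<and> n z \<in> N"
    using zN v(1) subspace_diff[OF N] by simp
next
  assume z: "z \<in> N \<and> n z \<in> N"
  have "z \<in> (\<lambda>z. z + t *\<^sub>R n z) ` N" for t :: real
  proof (rule image_eqI)
    show "z - t *\<^sub>R n z \<in> N"
      using z N by (simp add: subspace_diff subspace_scale)
    show "z = (z - t *\<^sub>R n z) + t *\<^sub>R n (z - t *\<^sub>R n z)"
      by (simp add: linear_diff[OF n] linear_scale[OF n] sq)
  qed
  then show "z \<in> (\<Inter>t::real. (\<lambda>z. z + t *\<^sub>R n z) ` N)"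
    by blast
qed

text \<open>
  Any \<open>z\<close> common to all the images is either killed by \<open>n\<close> or sent by \<open>n\<close> to a non-zero element
  of the kernel, and both \<open>z\<close> and \<open>n z\<close> are in \<open>N\<close>.
\<close>

lemma Inter_shear_images_nonzero_iff:
  fixes n :: "'a::real_vector \<Rightarrow> 'a"
  assumes n: "linear n" and sq: "\<And>z. n (n z) = 0" and N: "subspace N"
  shows "(\<Inter>t::real. (\<lambda>z. z + t *\<^sub>R n z) ` N) \<noteq> {0} \<longleftrightarrow> (\<exists>z\<in>N. z \<noteq> 0 \<and> n z = 0)"
proof -
  have eq: "(\<Inter>t::real. (\<lambda>z. z + t *\<^sub>R n z) ` N) = {z \<in> N. n z \<in> N}"
    using mem_Inter_shear_images_iff[OF n sq N] by blast
  have "0 \<in> {z \<in> N. n z \<in> N}"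
    using subspace_0[OF N] by (simp add: linear_0[OF n])
  then have "{z \<in> N. n z \<in> N} \<noteq> {0} \<longleftrightarrow> (\<exists>z\<in>N. z \<noteq> 0 \<and> n z \<in> N)"
    by blast
  also have "\<dots> \<longleftrightarrow> (\<exists>z\<in>N. z \<noteq> 0 \<and> n z = 0)"
    using sq subspace_0[OF N] by metis
  finally show ?thesis
    by (simp only: eq)
qed

section \<open>The infinitesimal generators of the two groups\<close>

lemma linear_proj:
  fixes M :: "'a::{real_inner, complete_space} set"
  assumes M: "subspace M" "closed M"
  shows "linear (proj M)"
proof (rule linearI)
  note p = proj_props[OF M]
  fix z z' :: 'a and c :: real
  have "(z - proj M z) + (z' - proj M z') \<in> M\<^sup>\<bottom>" "c *\<^sub>R (z - proj M z) \<in> M\<^sup>\<bottom>"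
    using p(2) by (simp_all add: subspace_add subspace_scale subspace_orthogonal_comp)
  then show "proj M (z + z') = proj M z + proj M z'" "proj M (c *\<^sub>R z) = c *\<^sub>R proj M z"
    using p(1) M(1)
    by (auto intro!: proj_unique[OF M(1)] simp: subspace_add subspace_scale algebra_simps)
qed

locale unitary_splitting =
  fixes M :: "'a::{real_inner, complete_space} set" and U :: "'a \<Rightarrow> 'a"
  assumes M: "subspace M" "closed M" and U: "unitary_between M (M\<^sup>\<bottom>) U"
begin

lemmas M_perp = subspace_orthogonal_comp[of M] closed_comp[of M]

lemma U_in: "x \<in> M \<Longrightarrow> U x \<in> M\<^sup>\<bottom>"
  and U_add: "x \<in> M \<Longrightarrow> x' \<in> M \<Longrightarrow> U (x + x') = U x + U x'"
  and U_scale: "x \<in> M \<Longrightarrow> U (c *\<^sub>R x) = c *\<^sub>R U x"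
  using U by (auto simp: unitary_between_def linear_between_def)

lemma adj_in: "y \<in> M\<^sup>\<bottom> \<Longrightarrow> adj M U y \<in> M"
  and adj_add: "y \<in> M\<^sup>\<bottom> \<Longrightarrow> y' \<in> M\<^sup>\<bottom> \<Longrightarrow> adj M U (y + y') = adj M U y + adj M U y'"
  and adj_scale: "y \<in> M\<^sup>\<bottom> \<Longrightarrow> adj M U (c *\<^sub>R y) = c *\<^sub>R adj M U y"
  using unitary_adj(1)[OF M(1) U] by (auto simp: unitary_between_def linear_between_def)

lemma adj_U: "x \<in> M \<Longrightarrow> adj M U (U x) = x"
  by (rule adj_unitary[OF M(1) U])

lemma U_adj: "y \<in> M\<^sup>\<bottom> \<Longrightarrow> U (adj M U y) = y"
  by (rule unitary_adj(2)[OF M(1) U])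

lemma U_eq_0_iff: "x \<in> M \<Longrightarrow> U x = 0 \<longleftrightarrow> x = 0"
  using U by (metis norm_eq_zero unitary_between_def)

lemma U_0: "U 0 = 0"
  using U_eq_0_iff subspace_0[OF M(1)] by blast

lemma adj_0: "adj M U 0 = 0"
  using adj_U[OF subspace_0[OF M(1)]] by (simp add: U_0)

lemma orthogonal_M_perp: "x \<in> M \<Longrightarrow> y \<in> M\<^sup>\<bottom> \<Longrightarrow> inner x y = 0"
  by (simp add: in_comp)

lemma splitting_cases:
  obtains x y where "x \<in> M" "y \<in> M\<^sup>\<bottom>" "z = y + x"
  using proj_props[OF M, of z] by (metis diff_add_cancel)

lemma linear_U_proj: "linear (\<lambda>z. U (proj M z))"
  using linear_proj[OF M] proj_props[OF M]
  by (intro linearI) (simp_all add: linear_add linear_scale U_add U_scale)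

lemma linear_adj_proj: "linear (\<lambda>z. adj M U (proj (M\<^sup>\<bottom>) z))"
  using linear_proj[OF M_perp] proj_props[OF M_perp]
  by (intro linearI) (simp_all add: linear_add linear_scale adj_add adj_scale)

text \<open>
  Subtracting the identity from the group element with parameter \<open>t\<close> leaves \<open>t\<close> times the matrix
  with rows \<open>(- l, l\<^sup>2)\<close> and \<open>(- 1, l)\<close>.  This has rank one: it is the row \<open>(- 1, l)\<close> followed by
  the column with entries \<open>l\<close> and \<open>1\<close>.  The two factors give the maps \<open>H \<rightarrow> M \<rightarrow> H\<close> below.  The
  first vanishes exactly on the graph of the scalar \<open>l\<close>, which is the range of the second; this is
  why the composite squares to zero and has that graph as its kernel.
\<close>

definition slope_defect :: "real \<Rightarrow> 'a \<Rightarrow> 'a" where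
  "slope_defect l z = l *\<^sub>R proj M z - adj M U (proj (M\<^sup>\<bottom>) z)"

definition generator_fin :: "real \<Rightarrow> 'a \<Rightarrow> 'a" where
  "generator_fin l z = l *\<^sub>R U (slope_defect l z) + slope_defect l z"

lemma slope_defect_in: "slope_defect l z \<in> M"
  using proj_props(1)[OF M] proj_props(1)[OF M_perp] M(1)
  by (simp add: slope_defect_def adj_in subspace_diff subspace_scale)

lemma slope_defect_sum:
  "x \<in> M \<Longrightarrow> y \<in> M\<^sup>\<bottom> \<Longrightarrow> slope_defect l (y + x) = l *\<^sub>R x - adj M U y"
  by (simp add: slope_defect_def proj_sum[OF M])

lemma slope_defect_graph: "x \<in> M \<Longrightarrow> slope_defect l (l *\<^sub>R U x + x) = 0"
  using U_in by (simp add: slope_defect_sum subspace_scale[OF M_perp(1)] adj_scale adj_U)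

lemma linear_slope_defect: "linear (slope_defect l)"
  unfolding slope_defect_def
  by (intro linear_compose_sub linear_compose_scale_right linear_proj[OF M] linear_adj_proj)

lemma linear_generator_fin: "linear (generator_fin l)"
  using linear_slope_defect[of l]
  by (intro linearI)
    (simp_all add: generator_fin_def linear_add linear_scale slope_defect_in U_add U_scale algebra_simps)

lemma generator_fin_square: "generator_fin l (generator_fin l z) = 0"
  using slope_defect_graph[OF slope_defect_in] by (simp add: generator_fin_def U_0)

lemma generator_fin_eq_0_iff: "generator_fin l z = 0 \<longleftrightarrow> (\<exists>x\<in>M. z = l *\<^sub>R U x + x)"
proof
  assume "generator_fin l z = 0"
  then have "proj M (l *\<^sub>R U (slope_defect l z) + slope_defect l z) = 0"
    using linear_0[OF linear_proj[OF M]] by (simp add: generator_fin_def)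
  then have w: "slope_defect l z = 0"
    using proj_sum(1)[OF M slope_defect_in] U_in[OF slope_defect_in] subspace_scale[OF M_perp(1)]
    by metis
  obtain x y where z: "x \<in> M" "y \<in> M\<^sup>\<bottom>" "z = y + x"
    by (rule splitting_cases)
  have "adj M U y = l *\<^sub>R x"
    using w z by (simp add: slope_defect_sum)
  then have "y = l *\<^sub>R U x"
    using U_adj[OF z(2)] U_scale[OF z(1)] by metis
  then show "\<exists>x\<in>M. z = l *\<^sub>R U x + x"
    using z by blast
next
  assume "\<exists>x\<in>M. z = l *\<^sub>R U x + x"
  then show "generator_fin l z = 0"
    by (auto simp: generator_fin_def slope_defect_graph U_0)
qed

lemma act_N_fin:
  "act M U (vector [vector [1 - l * t, l\<^sup>2 * t], vector [- t, 1 + l * t]]) z = z + t *\<^sub>R generator_fin l z"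
proof -
  obtain x y where z: "x \<in> M" "y \<in> M\<^sup>\<bottom>" "z = y + x"
    by (rule splitting_cases)
  have "U (l *\<^sub>R x - adj M U y) = l *\<^sub>R U x - y"
    using U_add[of "l *\<^sub>R x" "(-1) *\<^sub>R adj M U y"] U_scale[of _ "-1"] z adj_in M(1)
    by (simp add: U_scale U_adj subspace_scale subspace_neg)
  then show ?thesis
    by (simp add: z(3) act_def Let_def generator_fin_def slope_defect_sum[OF z(1,2)]
        proj_sum[OF M z(1,2)])
      (simp add: algebra_simps power2_eq_square)
qed

lemma act_N_sh:
  "act M U (vector [vector [1, t], vector [0, 1]]) z = z + t *\<^sub>R U (proj M z)"
proof -
  obtain x y where "x \<in> M" "y \<in> M\<^sup>\<bottom>" "z = y + x"
    by (rule splitting_cases)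
  then show ?thesis
    by (simp add: act_def Let_def proj_sum[OF M])
qed

lemma Inter_N_fin_nonzero_iff:
  assumes "subspace N"
  shows "(\<Inter>g\<in>N_fin l. act M U g ` N) \<noteq> {0} \<longleftrightarrow> (\<exists>x\<in>M. x \<noteq> 0 \<and> l *\<^sub>R U x + x \<in> N)"
proof -
  have eq: "(\<Inter>g\<in>N_fin l. act M U g ` N) = (\<Inter>t::real. (\<lambda>z. z + t *\<^sub>R generator_fin l z) ` N)"
    by (simp add: N_fin_def full_SetCompr_eq act_N_fin[abs_def])
  have "l *\<^sub>R U x + x = 0 \<longleftrightarrow> x = 0" if "x \<in> M" for x
    using proj_sum(1)[OF M that, of "l *\<^sub>R U x"] U_in[OF that] linear_0[OF linear_proj[OF M]]
    by (auto simp: subspace_scale[OF M_perp(1)] U_0)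
  then show ?thesis
    unfolding eq generator_fin_eq_0_iff
      Inter_shear_images_nonzero_iff[OF linear_generator_fin[of l] generator_fin_square assms]
    by metis
qed

lemma Inter_N_sh_nonzero_iff:
  assumes "subspace N"
  shows "(\<Inter>g\<in>N_sh. act M U g ` N) \<noteq> {0} \<longleftrightarrow> M\<^sup>\<bottom> \<inter> N \<noteq> {0}"
proof -
  have eq: "(\<Inter>g\<in>N_sh. act M U g ` N) = (\<Inter>t::real. (\<lambda>z. z + t *\<^sub>R U (proj M z)) ` N)"
    by (simp add: N_sh_def full_SetCompr_eq act_N_sh[abs_def])
  have proj_perp: "proj M z = 0 \<longleftrightarrow> z \<in> M\<^sup>\<bottom>" for z
    using proj_unique[OF M(1) subspace_0[OF M(1)], of z] proj_props(2)[OF M, of z] by auto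
  have ker: "U (proj M z) = 0 \<longleftrightarrow> z \<in> M\<^sup>\<bottom>" for z
    using proj_props(1)[OF M] by (simp add: U_eq_0_iff proj_perp)
  have sq: "U (proj M (U (proj M z))) = 0" for z
    unfolding ker using proj_props(1)[OF M] U_in by blast
  have "0 \<in> M\<^sup>\<bottom> \<inter> N"
    using subspace_0[OF M_perp(1)] subspace_0[OF assms] by blast
  then show ?thesis
    unfolding eq Inter_shear_images_nonzero_iff[OF linear_U_proj sq assms] ker by blast
qed

section \<open>Eigenvectors as vectors of a Lagrangian subspace\<close>

lemma lagrangian_isotropic:
  assumes "lagrangian M U N" "y + x \<in> N" "y' + x' \<in> N"
    and "x \<in> M" "y \<in> M\<^sup>\<bottom>" "x' \<in> M" "y' \<in> M\<^sup>\<bottom>"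
  shows "inner (U x) y' = inner (adj M U y) x'"
proof -
  have "symp M U (y + x) (y' + x') = 0"
    using assms(1-3) by (auto simp: lagrangian_def symp_comp_def)
  then show ?thesis
    using symp_sum[OF M assms(4-7)] by simp
qed

text \<open>
  A vector of \<open>M\<close> pairs with \<open>(y', x')\<close> as \<open>\<langle>x, U\<^sup>* y'\<rangle>\<close>, so inside \<open>M\<close> membership in the Lagrangian
  \<open>N\<close> is a system of orthogonality conditions.  Closedness makes the orthogonal projection onto
  \<open>M \<inter> N\<close> available.
\<close>

lemma closed_M_Int_lagrangian:
  assumes L: "lagrangian M U N"
  shows "closed (M \<inter> N)"
proof -
  have "M \<inter> N = M \<inter> ((\<lambda>z'. adj M U (proj (M\<^sup>\<bottom>) z')) ` N)\<^sup>\<bottom>"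
  proof -
    have "x \<in> N \<longleftrightarrow> (\<forall>z'\<in>N. inner (adj M U (proj (M\<^sup>\<bottom>) z')) x = 0)" if x: "x \<in> M" for x
    proof -
      have p: "proj M x = x" "proj (M\<^sup>\<bottom>) x = 0"
        using proj_sum[OF M x subspace_0[OF M_perp(1)]] by simp_all
      have "symp M U x z' = inner (adj M U (proj (M\<^sup>\<bottom>) z')) x" for z'
        using adj_inner(1)[OF M(1) U x proj_props(1)[OF M_perp], of z']
        by (simp add: symp_def p adj_0 inner_commute[of x])
      moreover have "x \<in> N \<longleftrightarrow> (\<forall>z'\<in>N. symp M U x z' = 0)"
        using L by (auto simp: lagrangian_def symp_comp_def)
      ultimately show ?thesis
        by simp
    qed
    then show ?thesis
      by (auto simp: in_comp)
  qed
  then show ?thesis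
    using M(2) closed_comp by (metis closed_Int)
qed

lemma N_sharp_plus_N_zero:
  assumes L: "lagrangian M U N"
  shows "N_sharp M N + N_zero M N = N \<inter> (M\<^sup>\<bottom> \<inter> N)\<^sup>\<bottom>"
  unfolding N_sharp_def N_zero_def N_inf_def M00_def M10_def
  by (rule closed_comp_part)
    (use M M_perp L closed_M_Int_lagrangian[OF L] orthogonal_M_perp
      in \<open>auto simp: subspace_inter lagrangian_def\<close>)

text \<open>
  The graph of the first operator is the part of \<open>N\<close> orthogonal to \<open>M\<^sup>\<bottom> \<inter> N\<close>.  A vector
  \<open>(l U x, x)\<close> of \<open>N\<close> is in that part because its symplectic product with \<open>(y, 0)\<close> in \<open>N\<close> is
  \<open>\<langle>U x, y\<rangle>\<close>, which therefore vanishes.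
\<close>

lemma eigenvalue_iff_scalar_graph_meets:
  assumes L: "lagrangian M U N" and R: "represents M U N T"
  shows "eigenvalue T l \<longleftrightarrow> (\<exists>x\<in>M. x \<noteq> 0 \<and> l *\<^sub>R U x + x \<in> N)"
proof -
  obtain D f where T: "fst T = (D, f)"
    by (metis surj_pair)
  have graph: "N \<inter> (M\<^sup>\<bottom> \<inter> N)\<^sup>\<bottom> = {U (f x) + x | x. x \<in> D}"
    using R N_sharp_plus_N_zero[OF L] by (simp add: represents_def T)
  have K: "M0 M N + M00 M N \<subseteq> M"
    using M(1) by (auto simp: M0_def M00_def elim!: set_plus_elim intro: subspace_add)
  have D: "x \<in> M" "f x \<in> M" if "x \<in> D" for x
    using R K that by (auto simp: represents_def selfadjoint_on_def linear_between_def T)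
  show ?thesis
  proof
    assume "eigenvalue T l"
    then obtain x where x: "x \<in> D" "x \<noteq> 0" "f x = l *\<^sub>R x"
      by (auto simp: eigenvalue_def T)
    have "U (f x) + x \<in> N"
      using graph x(1) by blast
    then show "\<exists>x\<in>M. x \<noteq> 0 \<and> l *\<^sub>R U x + x \<in> N"
      using x D(1) U_scale by auto
  next
    assume "\<exists>x\<in>M. x \<noteq> 0 \<and> l *\<^sub>R U x + x \<in> N"
    then obtain x where x: "x \<in> M" "x \<noteq> 0" "l *\<^sub>R U x + x \<in> N"
      by blast
    have lU: "l *\<^sub>R U x \<in> M\<^sup>\<bottom>"
      using U_in[OF x(1)] subspace_scale[OF M_perp(1)] by blast
    have "inner y (l *\<^sub>R U x + x) = 0" if y: "y \<in> M\<^sup>\<bottom>" "y \<in> N" for y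
    proof -
      have "inner (U x) y = 0"
        using lagrangian_isotropic[OF L x(3), of y 0] x(1) lU y subspace_0[OF M(1)] by simp
      then show ?thesis
        using orthogonal_M_perp[OF x(1) y(1)] by (simp add: inner_add_right inner_commute)
    qed
    then have "l *\<^sub>R U x + x \<in> N \<inter> (M\<^sup>\<bottom> \<inter> N)\<^sup>\<bottom>"
      using x(3) by (simp add: in_comp)
    then obtain x' where x': "x' \<in> D" "l *\<^sub>R U x + x = U (f x') + x'"
      unfolding graph by blast
    have "x = x'" "l *\<^sub>R U x = U (f x')"
      using proj_sum[OF M x(1) lU] proj_sum[OF M D(1)[OF x'(1)] U_in[OF D(2)[OF x'(1)]]] x'(2)
      by simp_all
    then have "f x = l *\<^sub>R x"
      using adj_U[OF D(2)[OF x'(1)]] adj_U[OF x(1)] adj_scale[OF U_in[OF x(1)]] by metis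
    then show "eigenvalue T l"
      using x(2) x'(1) \<open>x = x'\<close> by (auto simp: eigenvalue_def T)
  qed
qed

end

theorem proposition9:
  fixes M N :: "'a::{real_inner, polish_space} set"
    and U :: "'a \<Rightarrow> 'a"
    and T :: "'a bifredholm"
  assumes "subspace M" and "closed M"
    and "unitary_between M (M\<^sup>\<bottom>) U"
    and "lagrangian M U N"
    and "represents M U N T"
  shows "(\<forall>l::real. eigenvalue T l \<longleftrightarrow> (\<Inter>g\<in>N_fin l. act M U g ` N) \<noteq> {0}) \<and>
         (infinite_eigenvalue M N \<longleftrightarrow> (\<Inter>g\<in>N_sh. act M U g ` N) \<noteq> {0})"
proof -
  interpret unitary_splitting M U
    by unfold_locales (fact assms)+
  have N: "subspace N"
    using assms(4) by (simp add: lagrangian_def)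
  show ?thesis
    using eigenvalue_iff_scalar_graph_meets[OF assms(4,5)] Inter_N_fin_nonzero_iff[OF N]
      Inter_N_sh_nonzero_iff[OF N]
    by (simp add: infinite_eigenvalue_def N_inf_def M10_def)
qed

end
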